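(* Let $f : B(\Omega,\mathcal{A})\rightarrow \mathbb{R}$ be a monotone pricing rule. Then the following are equivalent: (i) $f$ satisfies the Call-Put Parity (CPP); (ii) $f$ is a Choquet-Šipoš pricing rule.
   Context: $\Omega$ is a set (finite or infinite) endowed with a $\sigma$-algebra $\mathcal{A}$, and $B(\Omega,\mathcal{A})$ is the set of all bounded, $\mathcal{A}$-measurable functions $x:\Omega\to\mathbb{R}$, with pointwise operations and pointwise order. For $A\in\mathcal{A}$, $\boldsymbol{1}_A$ is the indicator function of $A$. For $x\in B(\Omega,\mathcal{A})$, $x^+ := x\vee 0$ and $x^-:=(-x)\vee 0$. A pricing rule is a function $f:B(\Omega,\mathcal{A})\to\mathbb{R}$ that is not identically zero. It is monotone if $x\ge x'$ implies $f(x)\ge f(x')$. For $x\in B(\Omega,\mathcal{A})$ and $k\ge 0$, let $c_{x,k}=(x-k\boldsymbol{1}_\Omega)^+$ and $p_{x,k}=(k\boldsymbol{1}_\Omega-x)^+$. CPP: $f(p_{x,k})=f(c_{x,k})+f(-x)+f(k\boldsymbol{1}_\Omega)$ for all $x\in B(\Omega,\mathcal{A})$ and all $k\ge 0$. A capacity on $(\Omega,\mathcal{A})$ is a set function $v:\mathcal{A}\to\mathbb{R}$ with $v(\emptyset)=0$ and $v(A)\le v(B)$ whenever $A\subseteq B$, $A,B\in\mathcal{A}$. The Choquet integral of $x\in B(\Omega,\mathcal{A})$ with respect to $v$ is $$\int^C x\,dv:=\int_{-\infty}^0\big(v(\{x\geq t\})-v(\Omega)\big)\,dt + \int_0^{+\infty}v(\{x\geq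 t\})\,dt ,$$ and the Šipoš integral is $\int^S x\,dv:=\int^C x^+\,dv-\int^C x^-\,dv$. $f$ is a Choquet-Šipoš pricing rule if there is a single capacity $v$ such that $f(x)=\int^S x\,dv=\int^C x\,dv$ for all $x\in B(\Omega,\mathcal{A})$. *)

theory Defs
  imports "HOL-Analysis.Analysis"
begin

text \<open>
  Functions on \<open>\<Omega>\<close> are represented by their extension by 0 to the whole type, so that every
  function on \<open>\<Omega>\<close> has exactly one representative.  The operations below preserve this
  normal form; in particular the constant \<open>k\<close> is represented by \<open>k * indicator \<Omega>\<close>.
\<close>

definition bdd_meas :: "'a set \<Rightarrow> 'a set set \<Rightarrow> ('a \<Rightarrow> real) set" where
  "bdd_meas \<Omega> \<A> =
     {x. x \<in> borel_measurable (sigma \<Omega> \<A>) \<and> bounded (x ` \<Omega>) \<and> (\<forall>\<omega>. \<omega> \<notin> \<Omega> \<longrightarrow> x \<omega> = 0)}"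

definition const_fun :: "'a set \<Rightarrow> real \<Rightarrow> 'a \<Rightarrow> real" where
  "const_fun \<Omega> k = (\<lambda>\<omega>. k * indicator \<Omega> \<omega>)"

definition pos_part :: "('a \<Rightarrow> real) \<Rightarrow> 'a \<Rightarrow> real" where
  "pos_part x = (\<lambda>\<omega>. max (x \<omega>) 0)"

definition neg_part :: "('a \<Rightarrow> real) \<Rightarrow> 'a \<Rightarrow> real" where
  "neg_part x = (\<lambda>\<omega>. max (- x \<omega>) 0)"

definition call :: "'a set \<Rightarrow> ('a \<Rightarrow> real) \<Rightarrow> real \<Rightarrow> 'a \<Rightarrow> real" where
  "call \<Omega> x k = pos_part (\<lambda>\<omega>. x \<omega> - const_fun \<Omega> k \<omega>)"

definition put :: "'a set \<Rightarrow> ('a \<Rightarrow> real) \<Rightarrow> real \<Rightarrow> 'a \<Rightarrow> real" where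
  "put \<Omega> x k = pos_part (\<lambda>\<omega>. const_fun \<Omega> k \<omega> - x \<omega>)"

text \<open>Only the values of \<open>f\<close> on \<open>bdd_meas \<Omega> \<A>\<close> are relevant.\<close>

definition pricing_rule :: "'a set \<Rightarrow> 'a set set \<Rightarrow> (('a \<Rightarrow> real) \<Rightarrow> real) \<Rightarrow> bool" where
  "pricing_rule \<Omega> \<A> f \<longleftrightarrow> (\<exists>x\<in>bdd_meas \<Omega> \<A>. f x \<noteq> 0)"

definition monotone_rule :: "'a set \<Rightarrow> 'a set set \<Rightarrow> (('a \<Rightarrow> real) \<Rightarrow> real) \<Rightarrow> bool" where
  "monotone_rule \<Omega> \<A> f \<longleftrightarrow>
     (\<forall>x\<in>bdd_meas \<Omega> \<A>. \<forall>x'\<in>bdd_meas \<Omega> \<A>. (\<forall>\<omega>\<in>\<Omega>. x \<omega> \<ge> x' \<omega>) \<longrightarrow> f x \<ge> f x')"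

definition call_put_parity :: "'a set \<Rightarrow> 'a set set \<Rightarrow> (('a \<Rightarrow> real) \<Rightarrow> real) \<Rightarrow> bool" where
  "call_put_parity \<Omega> \<A> f \<longleftrightarrow>
     (\<forall>x\<in>bdd_meas \<Omega> \<A>. \<forall>k\<ge>0.
        f (put \<Omega> x k) = f (call \<Omega> x k) + f (\<lambda>\<omega>. - x \<omega>) + f (const_fun \<Omega> k))"

definition capacity :: "'a set set \<Rightarrow> ('a set \<Rightarrow> real) \<Rightarrow> bool" where
  "capacity \<A> v \<longleftrightarrow> v {} = 0 \<and> (\<forall>A\<in>\<A>. \<forall>B\<in>\<A>. A \<subseteq> B \<longrightarrow> v A \<le> v B)"

text \<open>
  For a capacity \<open>v\<close> and \<open>x\<close> in \<open>bdd_meas \<Omega> \<A>\<close> both integrands are monotone in \<open>t\<close> and vanish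
  outside a bounded interval, so the Riemann, Henstock-Kurzweil and Lebesgue integrals agree.
\<close>

definition choquet_integral :: "'a set \<Rightarrow> ('a set \<Rightarrow> real) \<Rightarrow> ('a \<Rightarrow> real) \<Rightarrow> real" where
  "choquet_integral \<Omega> v x =
     integral {..0} (\<lambda>t. v {\<omega>\<in>\<Omega>. x \<omega> \<ge> t} - v \<Omega>) + integral {0..} (\<lambda>t. v {\<omega>\<in>\<Omega>. x \<omega> \<ge> t})"

definition sipos_integral :: "'a set \<Rightarrow> ('a set \<Rightarrow> real) \<Rightarrow> ('a \<Rightarrow> real) \<Rightarrow> real" where
  "sipos_integral \<Omega> v x =
     choquet_integral \<Omega> v (pos_part x) - choquet_integral \<Omega> v (neg_part x)"

definition choquet_sipos_rule :: "'a set \<Rightarrow> 'a set set \<Rightarrow> (('a \<Rightarrow> real) \<Rightarrow> real) \<Rightarrow> bool" where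
  "choquet_sipos_rule \<Omega> \<A> f \<longleftrightarrow>
     (\<exists>v. capacity \<A> v \<and>
        (\<forall>x\<in>bdd_meas \<Omega> \<A>. f x = sipos_integral \<Omega> v x \<and> sipos_integral \<Omega> v x = choquet_integral \<Omega> v x))"

lemma bdd_meas_const_fun:
  assumes "sigma_algebra \<Omega> \<A>"
  shows "const_fun \<Omega> k \<in> bdd_meas \<Omega> \<A>"
proof -
  interpret sigma_algebra \<Omega> \<A> by fact
  have "\<Omega> \<in> sets (sigma \<Omega> \<A>)" by simp
  then have "const_fun \<Omega> k \<in> borel_measurable (sigma \<Omega> \<A>)"
    unfolding const_fun_def by measurable
  moreover have "bounded (const_fun \<Omega> k ` \<Omega>)"
    by (rule boundedI[where B = "\<bar>k\<bar>"]) (auto simp: const_fun_def)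
  ultimately show ?thesis
    by (auto simp: bdd_meas_def const_fun_def)
qed

lemma bdd_meas_uminus: "x \<in> bdd_meas \<Omega> \<A> \<Longrightarrow> (\<lambda>\<omega>. - x \<omega>) \<in> bdd_meas \<Omega> \<A>"
  by (auto simp: bdd_meas_def bounded_iff)

lemma bdd_meas_diff:
  "x \<in> bdd_meas \<Omega> \<A> \<Longrightarrow> y \<in> bdd_meas \<Omega> \<A> \<Longrightarrow> (\<lambda>\<omega>. x \<omega> - y \<omega>) \<in> bdd_meas \<Omega> \<A>"
  by (auto simp: bdd_meas_def intro!: bounded_minus_comp)

lemma bdd_meas_pos_part:
  assumes "x \<in> bdd_meas \<Omega> \<A>"
  shows "pos_part x \<in> bdd_meas \<Omega> \<A>"
proof -
  obtain B where "\<And>\<omega>. \<omega> \<in> \<Omega> \<Longrightarrow> \<bar>x \<omega>\<bar> \<le> B"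
    using assms by (auto simp: bdd_meas_def bounded_iff)
  then have "bounded (pos_part x ` \<Omega>)"
    by (intro boundedI[where B = B]) (force simp: pos_part_def max_def)
  then show ?thesis
    using assms by (auto simp: bdd_meas_def pos_part_def)
qed

lemma bdd_meas_neg_part: "x \<in> bdd_meas \<Omega> \<A> \<Longrightarrow> neg_part x \<in> bdd_meas \<Omega> \<A>"
  using bdd_meas_pos_part[OF bdd_meas_uminus] by (simp add: pos_part_def neg_part_def)

lemma bdd_meas_call:
  "sigma_algebra \<Omega> \<A> \<Longrightarrow> x \<in> bdd_meas \<Omega> \<A> \<Longrightarrow> call \<Omega> x k \<in> bdd_meas \<Omega> \<A>"
  unfolding call_def by (intro bdd_meas_pos_part bdd_meas_diff bdd_meas_const_fun)

lemma bdd_meas_put: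
  "sigma_algebra \<Omega> \<A> \<Longrightarrow> x \<in> bdd_meas \<Omega> \<A> \<Longrightarrow> put \<Omega> x k \<in> bdd_meas \<Omega> \<A>"
  unfolding put_def by (intro bdd_meas_pos_part bdd_meas_diff bdd_meas_const_fun)

end

theory Submission
  imports Defs
begin

text \<open>
  Call-put parity makes \<open>f\<close> odd, additive along constants, and hence additive along the
  decomposition \<open>x = (x - k)\<^sup>+ + min x k\<close>.  Put \<open>v A = f 1\<^sub>A\<close>.  For \<open>s \<le> t\<close> the slice
  \<open>(x - s)\<^sup>+ - (x - t)\<^sup>+\<close> lies between \<open>(t - s) 1\<^bsub>{x \<ge> t}\<^esub>\<close> and
  \<open>(t - s) 1\<^bsub>{x \<ge> s}\<^esub>\<close>, so monotonicity pins \<open>f (x - s)\<^sup>+ - f (x - t)\<^sup>+\<close> down to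
  the integral of \<open>v {x \<ge> \<cdot>}\<close> over \<open>[s, t]\<close>.  Conversely, a Choquet integral is additive
  along constants and a Sipos integral is odd, which together give the parity.
\<close>

section \<open>Integrals of monotone real functions\<close>

lemma antimono_integrable_on:
  fixes V :: "real \<Rightarrow> real"
  assumes "\<And>s t. a \<le> s \<Longrightarrow> s \<le> t \<Longrightarrow> t \<le> b \<Longrightarrow> V t \<le> V s"
  shows "V integrable_on {a..b}"
proof -
  have "mono_on {a..b} (\<lambda>t. - V t)"
    using assms by (auto simp: mono_on_def)
  then have "(\<lambda>t. - (- V t)) integrable_on {a..b}"
    by (intro integrable_neg integrable_on_mono_on)
  then show ?thesis by simp
qed

text \<open>Cuts the half-lines in the Choquet integral down to bounded intervals.\<close>

lemma integral_zero_extension: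
  fixes f :: "real \<Rightarrow> real"
  assumes "S \<subseteq> T" and "\<And>t. t \<in> T - S \<Longrightarrow> f t = 0"
  shows "integral T f = integral S f"
proof -
  have "integral T f = integral T (\<lambda>t. if t \<in> S then f t else 0)"
    by (rule integral_cong) (use assms(2) in auto)
  also have "\<dots> = integral S f"
    using assms(1) by (simp add: integral_restrict_Int Int_absorb2)
  finally show ?thesis .
qed

text \<open>The bounds force \<open>V\<close> to be decreasing, hence integrable. On a slice, the
  integral of \<open>V\<close> and \<open>G s - G t\<close> lie between the same two numbers, so
  they differ by at most \<open>(t - s) * (V s - V t)\<close>. Over \<open>n\<close> equal slices
  these errors sum to \<open>(b - a) * (V a - V b) / n\<close>, which is arbitrarily small.\<close>

lemma has_integral_of_slice_bounds:
  fixes V G :: "real \<Rightarrow> real"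
  assumes "a \<le> b"
    and lower: "\<And>s t. a \<le> s \<Longrightarrow> s \<le> t \<Longrightarrow> t \<le> b \<Longrightarrow> (t - s) * V t \<le> G s - G t"
    and upper: "\<And>s t. a \<le> s \<Longrightarrow> s \<le> t \<Longrightarrow> t \<le> b \<Longrightarrow> G s - G t \<le> (t - s) * V s"
  shows "(V has_integral (G a - G b)) {a..b}"
proof -
  have anti: "V t \<le> V s" if "a \<le> s" "s \<le> t" "t \<le> b" for s t
  proof (cases "s = t")
    case False
    then have "t - s > 0" using that by simp
    moreover have "(t - s) * V t \<le> (t - s) * V s"
      using lower[OF that] upper[OF that] by linarith
    ultimately show ?thesis by simp
  qed simp
  have integrable: "V integrable_on {s..t}" if "a \<le> s" "t \<le> b" for s t
    using that by (intro antimono_integrable_on anti) auto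
  have slice: "\<bar>integral {s..t} V - (G s - G t)\<bar> \<le> (t - s) * (V s - V t)"
    if st: "a \<le> s" "s \<le> t" "t \<le> b" for s t
  proof -
    have "integral {s..t} V \<le> integral {s..t} (\<lambda>_. V s)"
      using st by (intro integral_le integrable anti) auto
    moreover have "integral {s..t} (\<lambda>_. V t) \<le> integral {s..t} V"
      using st by (intro integral_le integrable anti) auto
    ultimately show ?thesis
      using lower[OF st] upper[OF st] st by (simp add: algebra_simps abs_le_iff)
  qed
  define e where "e = integral {a..b} V - (G a - G b)"
  have "real n * \<bar>e\<bar> \<le> (b - a) * (V a - V b)" if n: "n > 0" for n
  proof -
    define d where "d = (b - a) / n"
    have d: "d \<ge> 0" "n * d = b - a" using \<open>a \<le> b\<close> n by (auto simp: d_def)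
    \<comment> \<open>Since all slices have the same width \<open>d\<close>, the error bounds
      telescope along the induction.\<close>
    have "\<bar>integral {a..a + i * d} V - (G a - G (a + i * d))\<bar> \<le> d * (V a - V (a + i * d))"
      if "i \<le> n" for i
      using that
    proof (induction i)
      case (Suc i)
      let ?p = "a + i * d" and ?q = "a + Suc i * d"
      have "real (Suc i) * d \<le> n * d" using Suc.prems d(1) by (intro mult_right_mono) auto
      then have pq: "a \<le> ?p" "?p \<le> ?q" "?q \<le> b" using d by (auto simp: algebra_simps)
      have "integral {a..?q} V = integral {a..?p} V + integral {?p..?q} V"
        using pq by (intro Henstock_Kurzweil_Integration.integral_combine[symmetric] integrable) auto
      moreover have "?q - ?p = d" by (simp add: algebra_simps)
      ultimately show ?case
        using Suc.IH Suc.prems slice[OF pq] by (auto simp: right_diff_distrib)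
    qed simp
    from this[of n] have "\<bar>e\<bar> \<le> d * (V a - V b)"
      using d by (simp add: e_def)
    then have "n * \<bar>e\<bar> \<le> n * (d * (V a - V b))" by (intro mult_left_mono) auto
    then show ?thesis using d(2) by (metis mult.assoc)
  qed
  moreover have "0 \<le> (b - a) * (V a - V b)"
    using anti[of a b] \<open>a \<le> b\<close> by simp
  ultimately have "\<bar>e\<bar> = 0"
    by (intro real_archimedian_rdiv_eq_0) auto
  then show ?thesis
    using integrable[of a b] by (simp add: e_def has_integral_integrable_integral)
qed

section \<open>Bounded measurable functions and their Choquet integrals\<close>

lemma bdd_meas_superlevel:
  assumes "sigma_algebra \<Omega> \<A>" and "x \<in> bdd_meas \<Omega> \<A>"
  shows "{\<omega>\<in>\<Omega>. t \<le> x \<omega>} \<in> \<A>"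
proof -
  interpret sigma_algebra \<Omega> \<A> by fact
  have "x \<in> borel_measurable (sigma \<Omega> \<A>)" using assms by (simp add: bdd_meas_def)
  then have "{\<omega> \<in> space (sigma \<Omega> \<A>). t \<le> x \<omega>} \<in> sets (sigma \<Omega> \<A>)" by measurable
  then show ?thesis by simp
qed

lemma bdd_meas_bounds:
  assumes "x \<in> bdd_meas \<Omega> \<A>"
  obtains B where "B \<ge> 0" "\<And>\<omega>. \<omega> \<in> \<Omega> \<Longrightarrow> - B \<le> x \<omega> \<and> x \<omega> \<le> B"
proof -
  obtain B where B: "\<And>\<omega>. \<omega> \<in> \<Omega> \<Longrightarrow> \<bar>x \<omega>\<bar> \<le> B"
    using assms by (auto simp: bdd_meas_def bounded_iff)
  show thesis by (rule that[of "max B 0"]) (use B in \<open>force simp: abs_le_iff\<close>)+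
qed

lemma bdd_meas_scaled_indicator:
  assumes "sigma_algebra \<Omega> \<A>" and "A \<in> \<A>"
  shows "(\<lambda>\<omega>. c * indicator A \<omega>) \<in> bdd_meas \<Omega> \<A>"
proof -
  interpret sigma_algebra \<Omega> \<A> by fact
  have A: "A \<in> sets (sigma \<Omega> \<A>)" "A \<subseteq> \<Omega>" using assms sets_into_space by auto
  have "(\<lambda>\<omega>. c * indicator A \<omega>) \<in> borel_measurable (sigma \<Omega> \<A>)"
    using A by measurable
  moreover have "bounded ((\<lambda>\<omega>. c * indicator A \<omega>) ` \<Omega>)"
    by (rule boundedI[where B = "\<bar>c\<bar>"]) (auto simp: indicator_def)
  moreover have "c * indicator A \<omega> = 0" if "\<omega> \<notin> \<Omega>" for \<omega>
    using A that by (auto simp: indicator_def)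
  ultimately show ?thesis by (simp add: bdd_meas_def)
qed

text \<open>Below \<open>a\<close> the level set is all of \<open>\<Omega>\<close>, above
  \<open>b\<close> it is empty. The term \<open>a * v \<Omega>\<close> is what remains of the
  stretch below \<open>a\<close> once the normalisation on the negative half-line is taken into
  account.\<close>

lemma choquet_integral_eq:
  assumes "sigma_algebra \<Omega> \<A>" and v: "capacity \<A> v" and x: "x \<in> bdd_meas \<Omega> \<A>"
    and "a \<le> b" and bounds: "\<And>\<omega>. \<omega> \<in> \<Omega> \<Longrightarrow> a \<le> x \<omega> \<and> x \<omega> \<le> b"
  shows "choquet_integral \<Omega> v x = integral {a..b} (\<lambda>t. v {\<omega>\<in>\<Omega>. x \<omega> \<ge> t}) + a * v \<Omega>"
proof -
  define V where "V t = v {\<omega>\<in>\<Omega>. x \<omega> \<ge> t}" for t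
  \<comment> \<open>The window \<open>{-M..M}\<close> contains both 0 and \<open>{a..b}\<close>, so
    the integral can be split at 0 and at \<open>a\<close>, \<open>b\<close> without cases on their
    signs.\<close>
  define M where "M = max \<bar>a\<bar> \<bar>b\<bar>"
  have M: "0 \<le> M" "- M \<le> a" "b \<le> M" by (auto simp: M_def)
  have anti: "V t \<le> V s" if "s \<le> t" for s t
  proof -
    have "{\<omega>\<in>\<Omega>. x \<omega> \<ge> t} \<subseteq> {\<omega>\<in>\<Omega>. x \<omega> \<ge> s}" using that by auto
    then show ?thesis
      using v bdd_meas_superlevel[OF assms(1) x] by (simp add: V_def capacity_def)
  qed
  have below: "V t = v \<Omega>" if "t \<le> a" for t
  proof -
    have "{\<omega>\<in>\<Omega>. x \<omega> \<ge> t} = \<Omega>" using bounds that by force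
    then show ?thesis by (simp add: V_def)
  qed
  have above: "V t = 0" if "b < t" for t
  proof -
    have "{\<omega>\<in>\<Omega>. x \<omega> \<ge> t} = {}" using bounds that by force
    then show ?thesis using v by (simp only: V_def capacity_def)
  qed
  have integrable: "V integrable_on {s..t}" for s t
    by (intro antimono_integrable_on anti)
  have "((\<lambda>t. V t - v \<Omega>) has_integral (integral {-M..0} V - M * v \<Omega>)) {-M..0}"
    using has_integral_diff[OF integrable_integral[OF integrable]
        has_integral_const_real[of "v \<Omega>" "- M" 0]] M by simp
  then have neg: "integral {..0} (\<lambda>t. V t - v \<Omega>) = integral {-M..0} V - M * v \<Omega>"
    by (subst integral_zero_extension[of "{-M..0}"]) (use M below in \<open>auto intro: integral_unique\<close>)
  have pos: "integral {0..} V = integral {0..M} V"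
    by (rule integral_zero_extension) (use M above in auto)
  have "integral {-M..a} V = integral {-M..a} (\<lambda>_. v \<Omega>)"
    by (rule integral_cong) (use below in auto)
  then have left: "integral {-M..a} V = (a + M) * v \<Omega>" using M by simp
  \<comment> \<open>At \<open>t = b\<close> itself the level set may be nonempty; this single point
    is a null set.\<close>
  have "integral {b..M} V = integral {b..M} (\<lambda>_. 0)"
    by (rule integral_spike[of "{b}"]) (use above in auto)
  then have right: "integral {b..M} V = 0" by simp
  have "integral {-M..0} V + integral {0..M} V = integral {-M..M} V"
    using M by (intro Henstock_Kurzweil_Integration.integral_combine integrable) auto
  also have "\<dots> = integral {-M..a} V + integral {a..M} V"
    using M \<open>a \<le> b\<close> by (intro Henstock_Kurzweil_Integration.integral_combine[symmetric] integrable) auto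
  also have "integral {a..M} V = integral {a..b} V + integral {b..M} V"
    using M \<open>a \<le> b\<close> by (intro Henstock_Kurzweil_Integration.integral_combine[symmetric] integrable) auto
  finally show ?thesis
    using neg pos left right
    by (simp add: choquet_integral_def V_def[symmetric] algebra_simps)
qed

text \<open>Subtracting \<open>k\<close> translates the level sets by \<open>k\<close>: the integral
  over the translated window is unchanged, and only the boundary term moves, from
  \<open>- B * v \<Omega>\<close> to \<open>(- B - k) * v \<Omega>\<close>.\<close>

lemma choquet_integral_diff_const:
  assumes "sigma_algebra \<Omega> \<A>" and "capacity \<A> v" and x: "x \<in> bdd_meas \<Omega> \<A>"
  shows "choquet_integral \<Omega> v (\<lambda>\<omega>. x \<omega> - const_fun \<Omega> k \<omega>) = choquet_integral \<Omega> v x - k * v \<Omega>"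
proof -
  obtain B where B: "B \<ge> 0" "\<And>\<omega>. \<omega> \<in> \<Omega> \<Longrightarrow> - B \<le> x \<omega> \<and> x \<omega> \<le> B"
    using bdd_meas_bounds[OF x] by blast
  let ?V = "\<lambda>t. v {\<omega>\<in>\<Omega>. x \<omega> \<ge> t}"
  have "choquet_integral \<Omega> v (\<lambda>\<omega>. x \<omega> - const_fun \<Omega> k \<omega>) =
      integral {- B - k..B - k} (\<lambda>t. v {\<omega>\<in>\<Omega>. x \<omega> - const_fun \<Omega> k \<omega> \<ge> t}) + (- B - k) * v \<Omega>"
    using B by (intro choquet_integral_eq[OF assms(1,2)] bdd_meas_diff x bdd_meas_const_fun assms)
      (auto simp: const_fun_def)
  also have "(\<lambda>t. v {\<omega>\<in>\<Omega>. x \<omega> - const_fun \<Omega> k \<omega> \<ge> t}) = ?V \<circ> (+) k"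
    by (rule ext, unfold comp_def, rule arg_cong[where f = v]) (auto simp: const_fun_def)
  also have "integral {- B - k..B - k} (?V \<circ> (+) k) = integral {- B..B} ?V"
    by (simp add: integral_shift_Icc_real)
  also have "integral {- B..B} ?V = choquet_integral \<Omega> v x + B * v \<Omega>"
    using choquet_integral_eq[OF assms(1,2) x, of "- B" B] B by simp
  finally show ?thesis by (simp add: algebra_simps)
qed

section \<open>Choquet-Sipos rules satisfy the parity\<close>

lemma sipos_integral_uminus:
  "sipos_integral \<Omega> v (\<lambda>\<omega>. - x \<omega>) = - sipos_integral \<Omega> v x"
  by (simp add: sipos_integral_def pos_part_def neg_part_def)

text \<open>Evaluate \<open>f\<close> at \<open>x - k\<close> in two ways: the Sipos form gives call
  minus put, the Choquet form gives \<open>f x - k * v \<Omega>\<close>. Oddness of the Sipos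
  integral turns \<open>- f x\<close> into the value at \<open>-x\<close>.\<close>

lemma choquet_sipos_imp_parity:
  assumes sa: "sigma_algebra \<Omega> \<A>" and "choquet_sipos_rule \<Omega> \<A> f"
  shows "call_put_parity \<Omega> \<A> f"
proof -
  obtain v where v: "capacity \<A> v"
    and S: "\<And>x. x \<in> bdd_meas \<Omega> \<A> \<Longrightarrow> f x = sipos_integral \<Omega> v x"
    and C: "\<And>x. x \<in> bdd_meas \<Omega> \<A> \<Longrightarrow> f x = choquet_integral \<Omega> v x"
    using assms(2) unfolding choquet_sipos_rule_def by metis
  have "f (put \<Omega> x k) = f (call \<Omega> x k) + f (\<lambda>\<omega>. - x \<omega>) + f (const_fun \<Omega> k)"
    if x: "x \<in> bdd_meas \<Omega> \<A>" for x k
  proof -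
    define y where "y = (\<lambda>\<omega>. x \<omega> - const_fun \<Omega> k \<omega>)"
    have k: "const_fun \<Omega> k \<in> bdd_meas \<Omega> \<A>" by (rule bdd_meas_const_fun[OF sa])
    have y: "y \<in> bdd_meas \<Omega> \<A>" unfolding y_def by (intro bdd_meas_diff x k)
    have parts: "pos_part y = call \<Omega> x k" "neg_part y = put \<Omega> x k"
      by (simp_all add: y_def call_def put_def pos_part_def neg_part_def)
    have "f y = f (call \<Omega> x k) - f (put \<Omega> x k)"
      using S[OF y] C[OF bdd_meas_call[OF sa x]] C[OF bdd_meas_put[OF sa x]]
      by (simp add: sipos_integral_def parts)
    moreover have "f y = f x - k * v \<Omega>"
      using C[OF y] C[OF x] choquet_integral_diff_const[OF sa v x] by (simp add: y_def)
    \<comment> \<open>The window degenerates to the point \<open>k\<close>, so only the boundary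
      term survives.\<close>
    moreover have "f (const_fun \<Omega> k) = k * v \<Omega>"
      using C[OF k] choquet_integral_eq[OF sa v k, of k k] by (simp add: const_fun_def)
    moreover have "f (\<lambda>\<omega>. - x \<omega>) = - f x"
      using S[OF x] S[OF bdd_meas_uminus[OF x]] by (simp add: sipos_integral_uminus)
    ultimately show ?thesis by simp
  qed
  then show ?thesis by (simp add: call_put_parity_def)
qed

section \<open>Monotone solutions of the Cauchy equation on the half-line\<close>

lemma monotone_additive_imp_linear:
  fixes g :: "real \<Rightarrow> real"
  assumes add: "\<And>a b. 0 \<le> a \<Longrightarrow> 0 \<le> b \<Longrightarrow> g (a + b) = g a + g b"
    and mono: "\<And>a b. 0 \<le> a \<Longrightarrow> a \<le> b \<Longrightarrow> g a \<le> g b"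
    and "0 \<le> a"
  shows "g a = a * g 1"
proof -
  have g0: "g 0 = 0" using add[of 0 0] by simp
  have mult: "g (real n * b) = n * g b" if "0 \<le> b" for n b
  proof (induction n)
    case (Suc n)
    then show ?case using add[of b "real n * b"] that by (simp add: algebra_simps)
  qed (simp add: g0)
  have "real n * \<bar>g a - a * g 1\<bar> \<le> g 1" for n
  proof -
    \<comment> \<open>As \<open>n * a\<close> lies between \<open>m\<close> and
      \<open>m + 1\<close>, monotonicity traps \<open>n * g a\<close> between \<open>m * g 1\<close>
      and \<open>(m + 1) * g 1\<close>. So does \<open>n * a * g 1\<close>, and the gap
      \<open>g 1\<close> does not grow with \<open>n\<close>.\<close>
    define m where "m = nat \<lfloor>real n * a\<rfloor>"
    have m: "real m \<le> n * a" "n * a \<le> real (Suc m)"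
      using \<open>0 \<le> a\<close> unfolding m_def by (simp, linarith)
    have g1: "0 \<le> g 1" using mono[of 0 1] g0 by simp
    have "m * g 1 \<le> n * g a"
      using mono[OF _ m(1)] mult[of 1 m] mult[OF \<open>0 \<le> a\<close>, of n] by simp
    moreover have "n * g a \<le> (real m + 1) * g 1"
      using mono[OF _ m(2)] mult[of 1 "Suc m"] mult[OF \<open>0 \<le> a\<close>, of n] \<open>0 \<le> a\<close> by (simp add: add.commute)
    moreover have "m * g 1 \<le> n * a * g 1" "n * a * g 1 \<le> (real m + 1) * g 1"
      using m g1 by (auto intro!: mult_right_mono)
    ultimately have "\<bar>real n * g a - n * a * g 1\<bar> \<le> g 1"
      by (simp add: algebra_simps abs_le_iff)
    then show ?thesis by (simp add: abs_mult[symmetric, of "real n", simplified] algebra_simps)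
  qed
  moreover have "0 \<le> g 1" using mono[of 0 1] g0 by simp
  ultimately have "\<bar>g a - a * g 1\<bar> = 0"
    by (intro real_archimedian_rdiv_eq_0) auto
  then show ?thesis by simp
qed

section \<open>Algebraic consequences of the parity\<close>

locale monotone_parity_rule =
  fixes \<Omega> :: "'a set" and \<A> :: "'a set set" and f :: "('a \<Rightarrow> real) \<Rightarrow> real"
  assumes sa: "sigma_algebra \<Omega> \<A>"
    and monotone: "monotone_rule \<Omega> \<A> f"
    and parity: "call_put_parity \<Omega> \<A> f"
begin

lemma f_mono:
  assumes "x \<in> bdd_meas \<Omega> \<A>" "y \<in> bdd_meas \<Omega> \<A>" "\<And>\<omega>. \<omega> \<in> \<Omega> \<Longrightarrow> x \<omega> \<le> y \<omega>"
  shows "f x \<le> f y"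
  using monotone assms by (simp add: monotone_rule_def)

lemma f_parity:
  assumes "x \<in> bdd_meas \<Omega> \<A>" "k \<ge> 0"
  shows "f (put \<Omega> x k) = f (call \<Omega> x k) + f (\<lambda>\<omega>. - x \<omega>) + f (const_fun \<Omega> k)"
  using parity assms by (simp add: call_put_parity_def)

text \<open>At \<open>x = 0\<close>, \<open>k = 0\<close> the parity reads
  \<open>f 0 = 3 * f 0\<close>.\<close>

lemma f_zero: "f (\<lambda>_. 0) = 0"
  using f_parity[OF bdd_meas_const_fun[OF sa, of 0], of 0]
  by (simp add: const_fun_def put_def call_def pos_part_def)

text \<open>This is the parity at \<open>-x\<close> with strike 0, where the put pays the positive
  part of \<open>x\<close> and the call its negative part.\<close>

lemma f_parts:
  assumes x: "x \<in> bdd_meas \<Omega> \<A>"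
  shows "f x = f (pos_part x) - f (neg_part x)"
  using f_parity[OF bdd_meas_uminus[OF x], of 0] f_zero
  by (simp add: const_fun_def put_def call_def pos_part_def neg_part_def)

lemma f_uminus:
  assumes x: "x \<in> bdd_meas \<Omega> \<A>"
  shows "f (\<lambda>\<omega>. - x \<omega>) = - f x"
  using f_parts[OF x] f_parts[OF bdd_meas_uminus[OF x]]
  by (simp add: pos_part_def neg_part_def)

text \<open>Call and put are the positive and negative parts of \<open>x - k\<close>, so
  \<open>f_parts\<close> expresses the left side through them and the parity evaluates their
  difference.\<close>

lemma f_diff_const:
  assumes x: "x \<in> bdd_meas \<Omega> \<A>" and "k \<ge> 0"
  shows "f (\<lambda>\<omega>. x \<omega> - const_fun \<Omega> k \<omega>) = f x - f (const_fun \<Omega> k)"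
  using f_parts[OF bdd_meas_diff[OF x bdd_meas_const_fun[OF sa, of k]]]
    f_parity[OF x \<open>k \<ge> 0\<close>] f_uminus[OF x]
  by (simp add: put_def call_def pos_part_def neg_part_def)

text \<open>The remainder is the minimum of \<open>x\<close> and \<open>k\<close> on
  \<open>\<Omega>\<close>, which equals \<open>k\<close> minus the put. Its value is thus
  \<open>f (const_fun \<Omega> k) - f (put \<Omega> x k)\<close>, and the parity closes the
  sum.\<close>

lemma f_split:
  assumes x: "x \<in> bdd_meas \<Omega> \<A>" and "k \<ge> 0"
  shows "f x = f (call \<Omega> x k) + f (\<lambda>\<omega>. x \<omega> - call \<Omega> x k \<omega>)"
proof -
  have "(\<lambda>\<omega>. x \<omega> - call \<Omega> x k \<omega>) = (\<lambda>\<omega>. - (put \<Omega> x k \<omega> - const_fun \<Omega> k \<omega>))"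
    by (auto simp: put_def call_def pos_part_def max_def)
  then have "f (\<lambda>\<omega>. x \<omega> - call \<Omega> x k \<omega>) = f (\<lambda>\<omega>. - (put \<Omega> x k \<omega> - const_fun \<Omega> k \<omega>))"
    by (rule arg_cong)
  also have "\<dots> = - f (\<lambda>\<omega>. put \<Omega> x k \<omega> - const_fun \<Omega> k \<omega>)"
    by (intro f_uminus bdd_meas_diff bdd_meas_put bdd_meas_const_fun sa x)
  also have "\<dots> = f (const_fun \<Omega> k) - f (put \<Omega> x k)"
    using f_diff_const[OF bdd_meas_put[OF sa x] \<open>k \<ge> 0\<close>] by simp
  finally show ?thesis
    using f_parity[OF x \<open>k \<ge> 0\<close>] f_uminus[OF x] by simp
qed

section \<open>The induced capacity and the Choquet representation\<close>

definition v :: "'a set \<Rightarrow> real" where "v A = f (indicator A)"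

text \<open>Splitting \<open>(a + b)\<close> times an indicator at strike \<open>b\<close> leaves
  \<open>a\<close> times and \<open>b\<close> times the indicator, so \<open>f\<close> is additive
  in the scale; monotonicity then makes it linear.\<close>

lemma f_scaled_indicator:
  assumes A: "A \<in> \<A>" and "0 \<le> c"
  shows "f (\<lambda>\<omega>. c * indicator A \<omega>) = c * v A"
proof -
  interpret sigma_algebra \<Omega> \<A> by (rule sa)
  have sub: "A \<subseteq> \<Omega>" using A sets_into_space by auto
  define g where "g c = f (\<lambda>\<omega>. c * indicator A \<omega>)" for c
  note meas = bdd_meas_scaled_indicator[OF sa A]
  have "g (a + b) = g a + g b" if "0 \<le> a" "0 \<le> b" for a b
  proof -
    have "call \<Omega> (\<lambda>\<omega>. (a + b) * indicator A \<omega>) b = (\<lambda>\<omega>. a * indicator A \<omega>)"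
      using that sub by (auto simp: call_def pos_part_def const_fun_def indicator_def fun_eq_iff)
    then show ?thesis
      using f_split[OF meas \<open>0 \<le> b\<close>, of "a + b"] by (simp add: g_def algebra_simps)
  qed
  moreover have "g a \<le> g b" if "0 \<le> a" "a \<le> b" for a b
    unfolding g_def using that by (intro f_mono meas mult_right_mono) auto
  ultimately have "g c = c * g 1" using \<open>0 \<le> c\<close> by (intro monotone_additive_imp_linear) auto
  then show ?thesis by (simp add: g_def v_def)
qed

lemma capacity_v: "capacity \<A> v"
proof -
  have "indicator ({} :: 'a set) = (\<lambda>_. 0 :: real)" by auto
  then have "v {} = 0" by (simp add: v_def f_zero)
  moreover have "v A \<le> v B" if "A \<in> \<A>" "B \<in> \<A>" "A \<subseteq> B" for A B
    unfolding v_def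
  proof (rule f_mono)
    show "indicator A \<in> bdd_meas \<Omega> \<A>" "indicator B \<in> bdd_meas \<Omega> \<A>"
      using bdd_meas_scaled_indicator[OF sa, of _ 1] that by (metis (no_types, lifting) ext mult_1)+
    show "(indicator A \<omega> :: real) \<le> indicator B \<omega>" for \<omega>
      using that by (auto simp: indicator_def)
  qed
  ultimately show ?thesis by (auto simp: capacity_def)
qed

lemma f_const: "f (const_fun \<Omega> k) = k * v \<Omega>"
proof -
  interpret sigma_algebra \<Omega> \<A> by (rule sa)
  have nonneg: "f (const_fun \<Omega> k) = k * v \<Omega>" if "0 \<le> k" for k
    using f_scaled_indicator[OF top that] by (simp add: const_fun_def)
  show ?thesis
  proof (cases "0 \<le> k")
    case False
    then show ?thesis
      using nonneg[of "- k"] f_uminus[OF bdd_meas_const_fun[OF sa, of "- k"]]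
      by (simp add: const_fun_def)
  qed (rule nonneg)
qed

text \<open>The parity speaks of nonnegative strikes only. For negative \<open>k\<close>,
  subtracting the positive constant \<open>-k\<close> from \<open>x - k\<close> recovers
  \<open>x\<close>. The case \<open>k = - B\<close> serves the Choquet representation.\<close>

lemma f_diff_any_const:
  assumes x: "x \<in> bdd_meas \<Omega> \<A>"
  shows "f (\<lambda>\<omega>. x \<omega> - const_fun \<Omega> k \<omega>) = f x - k * v \<Omega>"
proof (cases "0 \<le> k")
  case True
  then show ?thesis using f_diff_const[OF x] by (simp add: f_const)
next
  case False
  let ?y = "\<lambda>\<omega>. x \<omega> - const_fun \<Omega> k \<omega>"
  have "f (\<lambda>\<omega>. ?y \<omega> - const_fun \<Omega> (- k) \<omega>) = f ?y - f (const_fun \<Omega> (- k))"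
    using False by (intro f_diff_const bdd_meas_diff x bdd_meas_const_fun sa) auto
  then show ?thesis by (simp add: f_const) (simp add: const_fun_def)
qed

lemma f_slice_bounds:
  assumes x: "x \<in> bdd_meas \<Omega> \<A>" and "s \<le> t"
  shows "(t - s) * v {\<omega>\<in>\<Omega>. x \<omega> \<ge> t} \<le> f (call \<Omega> x s) - f (call \<Omega> x t)"
    and "f (call \<Omega> x s) - f (call \<Omega> x t) \<le> (t - s) * v {\<omega>\<in>\<Omega>. x \<omega> \<ge> s}"
proof -
  let ?d = "\<lambda>\<omega>. call \<Omega> x s \<omega> - call \<Omega> x t \<omega>"
  note call = bdd_meas_call[OF sa x]
  have xO: "x \<omega> = 0" if "\<omega> \<notin> \<Omega>" for \<omega> using x that by (auto simp: bdd_meas_def)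
  \<comment> \<open>Iterating calls adds strikes. Hence \<open>f_split\<close>, used at the
    nonnegative strike \<open>t - s\<close>, turns the difference of values into the value of the
    slice, whatever the signs of \<open>s\<close> and \<open>t\<close>.\<close>
  have "call \<Omega> (call \<Omega> x s) (t - s) = call \<Omega> x t"
    using \<open>s \<le> t\<close> xO by (auto simp: call_def pos_part_def const_fun_def indicator_def fun_eq_iff)
  then have d: "f (call \<Omega> x s) - f (call \<Omega> x t) = f ?d"
    using f_split[OF call[of s], of "t - s"] \<open>s \<le> t\<close> by simp
  note sets = bdd_meas_superlevel[OF sa x]
  have "f (\<lambda>\<omega>. (t - s) * indicator {\<omega>\<in>\<Omega>. x \<omega> \<ge> t} \<omega>) \<le> f ?d"
    using \<open>s \<le> t\<close> by (intro f_mono bdd_meas_scaled_indicator[OF sa] sets bdd_meas_diff call)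
      (auto simp: call_def pos_part_def const_fun_def indicator_def)
  then show "(t - s) * v {\<omega>\<in>\<Omega>. x \<omega> \<ge> t} \<le> f (call \<Omega> x s) - f (call \<Omega> x t)"
    using f_scaled_indicator[OF sets] \<open>s \<le> t\<close> d by simp
  have "f ?d \<le> f (\<lambda>\<omega>. (t - s) * indicator {\<omega>\<in>\<Omega>. x \<omega> \<ge> s} \<omega>)"
    using \<open>s \<le> t\<close> by (intro f_mono bdd_meas_scaled_indicator[OF sa] sets bdd_meas_diff call)
      (auto simp: call_def pos_part_def const_fun_def indicator_def)
  then show "f (call \<Omega> x s) - f (call \<Omega> x t) \<le> (t - s) * v {\<omega>\<in>\<Omega>. x \<omega> \<ge> s}"
    using f_scaled_indicator[OF sets] \<open>s \<le> t\<close> d by simp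
qed

lemma f_eq_choquet:
  assumes x: "x \<in> bdd_meas \<Omega> \<A>"
  shows "f x = choquet_integral \<Omega> v x"
proof -
  obtain B where B: "B \<ge> 0" "\<And>\<omega>. \<omega> \<in> \<Omega> \<Longrightarrow> - B \<le> x \<omega> \<and> x \<omega> \<le> B"
    using bdd_meas_bounds[OF x] by blast
  have xO: "x \<omega> = 0" if "\<omega> \<notin> \<Omega>" for \<omega> using x that by (auto simp: bdd_meas_def)
  have "((\<lambda>t. v {\<omega>\<in>\<Omega>. x \<omega> \<ge> t}) has_integral (f (call \<Omega> x (- B)) - f (call \<Omega> x B))) {- B..B}"
    using B(1) by (intro has_integral_of_slice_bounds f_slice_bounds x) auto
  \<comment> \<open>At strike \<open>- B\<close> the call is always exercised and pays
    \<open>x + B\<close>; at strike \<open>B\<close> it pays nothing. The total is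
    \<open>f x + B * v \<Omega>\<close>, whose second term cancels the boundary term of
    \<open>choquet_integral_eq\<close>.\<close>
  moreover have "call \<Omega> x (- B) = (\<lambda>\<omega>. x \<omega> - const_fun \<Omega> (- B) \<omega>)"
    using B xO by (force simp: call_def pos_part_def const_fun_def indicator_def fun_eq_iff)
  moreover have "call \<Omega> x B = (\<lambda>_. 0)"
    using B xO by (force simp: call_def pos_part_def const_fun_def indicator_def fun_eq_iff)
  ultimately have "integral {- B..B} (\<lambda>t. v {\<omega>\<in>\<Omega>. x \<omega> \<ge> t}) = f x + B * v \<Omega>"
    by (simp add: integral_unique f_diff_any_const[OF x] f_zero)
  then show ?thesis
    using choquet_integral_eq[OF sa capacity_v x, of "- B" B] B by simp
qed

lemma choquet_sipos: "choquet_sipos_rule \<Omega> \<A> f"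
proof -
  \<comment> \<open>The Choquet representation is applied to both parts of \<open>x\<close>, with
    the same \<open>v\<close>.\<close>
  have "f x = sipos_integral \<Omega> v x" if "x \<in> bdd_meas \<Omega> \<A>" for x
    using f_parts[OF that] f_eq_choquet[OF bdd_meas_pos_part[OF that]]
      f_eq_choquet[OF bdd_meas_neg_part[OF that]]
    by (simp add: sipos_integral_def)
  then show ?thesis
    using capacity_v f_eq_choquet unfolding choquet_sipos_rule_def by metis
qed

end

theorem theorem2:
  fixes \<Omega> :: "'a set" and \<A> :: "'a set set" and f :: "('a \<Rightarrow> real) \<Rightarrow> real"
  assumes "sigma_algebra \<Omega> \<A>"
    and "pricing_rule \<Omega> \<A> f"
    and "monotone_rule \<Omega> \<A> f"
  shows "call_put_parity \<Omega> \<A> f \<longleftrightarrow> choquet_sipos_rule \<Omega> \<A> f"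
  using choquet_sipos_imp_parity[OF assms(1)]
    monotone_parity_rule.choquet_sipos[OF monotone_parity_rule.intro[OF assms(1,3)]]
  by blast

end
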